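(* There exists a connected component of $K$ that is not locally connected (as a subspace of $\mathbb{R}^2$), where $K\subset\mathbb{R}^2$ is the attractor of the iterated function system $\Phi=\{\varphi_i(\mathbf{x})=\frac{1}{6}\mathbf{x}+a_i\}_{i=1}^{24}$ with the translation vectors $a_1,\dots,a_{24}$ listed in the context.
   Context: The planar self-similar iterated function system is $\Phi=\{\varphi_i\}_{i=1}^{24}$, where $\varphi_i:\mathbb{R}^2\to\mathbb{R}^2$, $\varphi_i(\mathbf{x})=\frac{1}{6}\mathbf{x}+a_i$, and $a_1=(0,0)$, $a_2=(0,\frac{1}{6})$, $a_3=(0,\frac{1}{3})$, $a_4=(\frac{1}{24},\frac{1}{2})$, $a_5=(\frac{1}{12},\frac{2}{3})$, $a_6=(\frac{1}{8},\frac{5}{6})$, $a_7=(\frac{1}{6},0)$, $a_8=(\frac{5}{24},\frac{1}{6})$, $a_9=(\frac{1}{4},\frac{1}{3})$, $a_{10}=(\frac{7}{24},\frac{1}{2})$, $a_{11}=(\frac{1}{3},\frac{2}{3})$, $a_{12}=(\frac{3}{8},\frac{5}{6})$, $a_{13}=(\frac{5}{12},0)$, $a_{14}=(\frac{11}{24},\frac{1}{6})$, $a_{15}=(\frac{1}{2},\frac{1}{3})$, $a_{16}=(\frac{13}{24},\frac{1}{2})$, $a_{17}=(\frac{7}{12},\frac{2}{3})$, $a_{18}=(\frac{5}{8},\frac{5}{6})$, $a_{19}=(\frac{5}{6},0)$, $a_{20}=(\frac{5}{6},\frac{1}{6})$, $a_{21}=(\frac{5}{6},\frac{1}{3})$,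 $a_{22}=(\frac{5}{6},\frac{1}{2})$, $a_{23}=(\frac{5}{6},\frac{2}{3})$, $a_{24}=(\frac{5}{6},\frac{5}{6})$. The attractor $K$ of $\Phi$ is the unique nonempty compact set $K\subset\mathbb{R}^2$ with $K=\bigcup_{i=1}^{24}\varphi_i(K)$. A topological space $X$ is locally connected at $x\in X$ if for every neighborhood $U$ of $x$ there exists a connected neighborhood $V$ of $x$ contained in $U$; $X$ is locally connected if it is locally connected at each of its points. *)

theory Defs
  imports "HOL-Analysis.Analysis"
begin

definition attractor :: "'i set \<Rightarrow> ('i \<Rightarrow> 'a \<Rightarrow> 'a) \<Rightarrow> 'a::topological_space set"
  where "attractor I f = (THE K. compact K \<and> K \<noteq> {} \<and> K = (\<Union>i\<in>I. f i ` K))"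

(* The translations are numbered from 1, so the i-th one is the list entry at position i - 1. *)
definition translation :: "nat \<Rightarrow> real \<times> real"
  where "translation i =
    [(0, 0), (0, 1/6), (0, 1/3), (1/24, 1/2), (1/12, 2/3), (1/8, 5/6),
     (1/6, 0), (5/24, 1/6), (1/4, 1/3), (7/24, 1/2), (1/3, 2/3), (3/8, 5/6),
     (5/12, 0), (11/24, 1/6), (1/2, 1/3), (13/24, 1/2), (7/12, 2/3), (5/8, 5/6),
     (5/6, 0), (5/6, 1/6), (5/6, 1/3), (5/6, 1/2), (5/6, 2/3), (5/6, 5/6)] ! (i - 1)"

definition ifs :: "nat \<Rightarrow> real \<times> real \<Rightarrow> real \<times> real"
  where "ifs i x = (1/6) *\<^sub>R x + translation i"

definition K :: "(real \<times> real) set"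
  where "K = attractor {1..24} ifs"

(* The following facts show that the definite description in the definition of K is
   well-defined. *)

lemma dist_ifs: "dist (ifs i x) (ifs i y) = dist x y / 6"
  by (simp add: ifs_def dist_norm flip: scaleR_diff_right)

lemma continuous_on_ifs: "continuous_on S (ifs i)"
  unfolding ifs_def by (intro continuous_intros)

lemma ifs_image_compact:
  assumes "compact S" shows "compact (\<Union>i\<in>{1..24}. ifs i ` S)"
  using assms by (intro compact_UN) (auto intro: compact_continuous_image continuous_on_ifs)

lemma ifs_square: "(\<Union>i\<in>{1..24}. ifs i ` cbox (0,0) (1,1)) \<subseteq> cbox (0,0) (1,1)"
proof -
  have "\<forall>i\<in>set [1..<25]. 0 \<le> fst (translation i) \<and> fst (translation i) \<le> 5/6 \<and>
      0 \<le> snd (translation i) \<and> snd (translation i) \<le> 5/6"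
    by (simp add: translation_def upt_rec)
  then have "\<forall>i\<in>{1..24}. 0 \<le> fst (translation i) \<and> fst (translation i) \<le> 5/6 \<and>
      0 \<le> snd (translation i) \<and> snd (translation i) \<le> 5/6"
    by auto
  from bspec[OF this] have t: "0 \<le> fst (translation i)" "fst (translation i) \<le> 5/6"
      "0 \<le> snd (translation i)" "snd (translation i) \<le> 5/6" if "i \<in> {1..24}" for i
    using that by simp_all
  have "ifs i x \<in> cbox (0,0) (1,1)" if "i \<in> {1..24}" "x \<in> cbox (0,0) (1,1)" for i x
  proof -
    have "0 \<le> fst x" "fst x \<le> 1" "0 \<le> snd x" "snd x \<le> 1"
      using that(2) by (auto simp: cbox_Pair_eq mem_Times_iff)
    with t[OF that(1)] show ?thesis
      by (auto simp: ifs_def cbox_Pair_eq mem_Times_iff)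
  qed
  then show ?thesis by blast
qed

lemma ifs_invariant_exists:
  "\<exists>K. compact K \<and> K \<noteq> {} \<and> K = (\<Union>i\<in>{1..24}. ifs i ` K)"
proof -
  define F where "F S = (\<Union>i\<in>{1..24}. ifs i ` S)" for S
  define B where "B n = (F ^^ n) (cbox (0,0) (1,1))" for n
  define L where "L = (\<Inter>n. B n)"
  have F_mono: "F S \<subseteq> F T" if "S \<subseteq> T" for S T using that by (auto simp: F_def)
  have B_Suc: "B (Suc n) = F (B n)" for n by (simp add: B_def)
  have "B (Suc n) \<subseteq> B n" for n
  proof (induction n)
    case 0 show ?case using ifs_square by (simp add: B_def F_def)
  next
    case (Suc n) then show ?case using F_mono B_Suc by metis
  qed
  then have dec: "B n \<subseteq> B m" if "m \<le> n" for m n using that by (rule lift_Suc_antimono_le)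
  have comp: "compact (B n)" for n
    by (induction n) (auto simp: B_Suc, auto simp: B_def F_def intro!: ifs_image_compact[simplified])
  have ne: "B n \<noteq> {}" for n
    by (induction n) (auto simp: B_Suc F_def, simp add: B_def cbox_Pair_eq)
  have "L \<noteq> {}" unfolding L_def by (rule compact_nest[OF comp ne dec])
  moreover have "compact L"
    unfolding L_def using compact_Inter[of "range B"] comp by auto
  moreover have "F L \<subseteq> L"
  proof -
    have "F L \<subseteq> B n" for n
      using dec[of n "Suc n"] F_mono[of L "B n"] B_Suc by (auto simp: L_def)
    then show ?thesis by (auto simp: L_def)
  qed
  moreover have "L \<subseteq> F L"
  proof
    fix x assume x: "x \<in> L"
    have "\<exists>i\<in>{1..24}. \<exists>y. y \<in> B n \<and> x = ifs i y" for n
    proof -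
      have "x \<in> F (B n)" using x B_Suc[of n] by (auto simp: L_def)
      then show ?thesis by (auto simp: F_def)
    qed
    then obtain c where c: "\<And>n. c n \<in> {1..24::nat}" and c': "\<And>n. \<exists>y. y \<in> B n \<and> x = ifs (c n) y"
      by metis
    have "finite (range c)" using c by (meson finite_atLeastAtMost finite_subset image_subsetI)
    then obtain i where inf: "infinite {n. c n = i}" and i: "i \<in> {1..24}"
      using pigeonhole_infinite[of UNIV c] c by auto
    define y where "y = 6 *\<^sub>R (x - translation i)"
    have inj: "z = y" if "x = ifs i z" for z using that by (simp add: y_def ifs_def)
    have "y \<in> B n" for n
    proof -
      obtain m where m: "m \<ge> n" "c m = i"
        using inf unfolding infinite_nat_iff_unbounded_le by blast
      obtain z where z: "z \<in> B m" "x = ifs (c m) z" using c' by blast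
      have "z = y" using z(2) m(2) by (intro inj) simp
      then show ?thesis using z(1) subsetD[OF dec[OF m(1)]] by simp
    qed
    then have "y \<in> L" by (auto simp: L_def)
    moreover have "x = ifs i y" by (simp add: y_def ifs_def)
    ultimately show "x \<in> F L" using i by (auto simp: F_def)
  qed
  ultimately have "compact L \<and> L \<noteq> {} \<and> L = F L" by (simp add: subset_antisym)
  then show ?thesis unfolding F_def by (rule exI)
qed

lemma ifs_invariant_subset:
  assumes A: "compact A" "A = (\<Union>i\<in>{1..24}. ifs i ` A)"
    and B: "compact B" "B \<noteq> {}" "B = (\<Union>i\<in>{1..24}. ifs i ` B)"
  shows "A \<subseteq> B"
proof (cases "A = {}")
  case False
  have "\<exists>x\<in>A. \<forall>y\<in>A. infdist y B \<le> infdist x B"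
    by (intro continuous_attains_sup A(1) False continuous_on_infdist continuous_on_id)
  then obtain x where x: "x \<in> A" "\<And>y. y \<in> A \<Longrightarrow> infdist y B \<le> infdist x B"
    by metis
  obtain i y where i: "i \<in> {1..24}" and y: "y \<in> A" "x = ifs i y" using x(1) A(2) by blast
  obtain b where b: "b \<in> B" "infdist y B = dist y b"
    using infdist_attains_inf[OF compact_imp_closed[OF B(1)] B(2)] by metis
  have "ifs i b \<in> B" using b i B(3) by blast
  then have "infdist x B \<le> dist y b / 6"
    using infdist_le[of "ifs i b" B x] y(2) dist_ifs by metis
  also have "\<dots> \<le> infdist x B / 6" using x(2)[OF y(1)] b(2) by simp
  finally have "infdist x B \<le> 0" by simp
  then have "infdist z B = 0" if "z \<in> A" for z
    using x(2)[OF that] infdist_nonneg[of z B] by linarith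
  then show ?thesis
    using in_closed_iff_infdist_zero[OF compact_imp_closed[OF B(1)] B(2)] by blast
qed simp

lemma ifs_invariant_unique:
  "\<exists>!K. compact K \<and> K \<noteq> {} \<and> K = (\<Union>i\<in>{1..24}. ifs i ` K)"
proof (rule ex_ex1I[OF ifs_invariant_exists])
  fix A B :: "(real \<times> real) set"
  assume A: "compact A \<and> A \<noteq> {} \<and> A = (\<Union>i\<in>{1..24}. ifs i ` A)"
    and B: "compact B \<and> B \<noteq> {} \<and> B = (\<Union>i\<in>{1..24}. ifs i ` B)"
  note a = conjunct1[OF A] conjunct1[OF conjunct2[OF A]] conjunct2[OF conjunct2[OF A]]
  note b = conjunct1[OF B] conjunct1[OF conjunct2[OF B]] conjunct2[OF conjunct2[OF B]]
  show "A = B"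
    using ifs_invariant_subset[OF a(1,3) b] ifs_invariant_subset[OF b(1,3) a]
    by (rule subset_antisym)
qed

lemma K_attractor: "compact K" "K \<noteq> {}" "K = (\<Union>i\<in>{1..24}. ifs i ` K)"
proof -
  have K: "compact K \<and> K \<noteq> {} \<and> K = (\<Union>i\<in>{1..24}. ifs i ` K)"
    unfolding K_def attractor_def by (rule theI'[OF ifs_invariant_unique])
  show "compact K" by (rule conjunct1[OF K])
  show "K \<noteq> {}" by (rule conjunct1[OF conjunct2[OF K]])
  show "K = (\<Union>i\<in>{1..24}. ifs i ` K)" by (rule conjunct2[OF conjunct2[OF K]])
qed

end

theory Submission
  imports Defs
begin

text \<open>
  The 24 squares of side 1/6 form six rows of four. Write 24x for the horizontal coordinate.
  Going up one row moves the third square of the row by 1, and it starts at 10, so the third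
  squares follow the line x = 1/2 + y/4, which is therefore contained in K. Reading off how lines
  of slope 1/4 (dx/dy = 1/4) are mapped by the inverses of the similarities shows that K also
  contains the parallel lines x = 1/2 - e + y/4 for e = 6^-n / 4, hence a sequence of segments
  accumulating at a segment of K, and that between any two of them there is a parallel
  line that misses K, because there is a gap between the second and third squares of every row.
  These segments therefore lie in different components of K.

  They are tied together by the horizontal contact of the squares number 1 and 7. The right edge
  of the unit square lies in K, so the first square carries the vertical segment
  {1/6} \<times> [0, 1/6]. The lines x = y/4 - e with e = 6^-n / 4 belong to K as well and start on the
  left edge, so that their copies in the seventh square start on that vertical
  segment. All these copies lie in one component C. The fifth square of the first column maps
  the line x = 1/2 - e + y/4 onto part of the line x = y/4 - e/6, so the copies run through the
  corresponding square of level two, in which they are the accumulating segments described above.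
  In the interior of that square, K is a scaled copy of itself; so a connected part of C inside it
  that contains a point of the limit segment cannot meet the segments accumulating there, and C is
  not locally connected at that point.

  The lemma \<open>skeleton_subset_K\<close> provides the lines inside K, \<open>K_avoids_line\<close> the separating
  lines, and \<open>K_zoom\<close> the passage to the small square.
\<close>

section \<open>Rows and columns of the self-similarity\<close>

text \<open>The left ends, multiplied by 24, of the four squares in the row of height \<open>r / 6\<close>. The maximum
  makes the first three squares of the left column lie exactly above each other.\<close>

abbreviation columns :: "nat \<Rightarrow> real set"
  where "columns r \<equiv> {max 0 (real r - 2), real r + 4, real r + 10, 20}"

lemma translation_image:
  "translation ` {1..24} =
     (\<Union>r<6. \<Union>d\<in>columns r. {(d / 24, real r / 6)})"
proof -
  have 1: "{1..24::nat} = set [1..<25]" by auto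
  have 2: "{..<6::nat} = set [0..<6]" by auto
  show ?thesis unfolding 1 2
    by (simp add: translation_def upt_rec insert_commute)
qed

text \<open>The invariance of K, with the inverses of the similarities. Only the coordinates of a point
  and of its cell occur, so that all later case distinctions reduce to linear arithmetic.\<close>

lemma mem_K_iff:
  "(x, y) \<in> K \<longleftrightarrow>
     (\<exists>r<6. \<exists>d\<in>columns r. (6 * x - d / 4, 6 * y - real r) \<in> K)"
proof -
  have eq: "z = ifs i w \<longleftrightarrow> w = 6 *\<^sub>R (z - translation i)" for z w i
    by (auto simp: ifs_def)
  have "(x, y) \<in> K \<longleftrightarrow> (\<exists>i\<in>{1..24}. \<exists>w\<in>K. (x, y) = ifs i w)"
    using K_attractor(3) by blast
  also have "\<dots> \<longleftrightarrow> (\<exists>t\<in>translation ` {1..24}. 6 *\<^sub>R ((x, y) - t) \<in> K)"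
    unfolding eq by blast
  also have "\<dots> \<longleftrightarrow> (\<exists>r<6. \<exists>d\<in>columns r.
      6 *\<^sub>R ((x, y) - (d / 24, real r / 6)) \<in> K)"
    unfolding translation_image by blast
  also have "\<dots> \<longleftrightarrow> (\<exists>r<6. \<exists>d\<in>columns r.
      (6 * x - d / 4, 6 * y - real r) \<in> K)"
  proof -
    have "6 *\<^sub>R ((x, y) - (d / 24, real r / 6)) = (6 * x - d / 4, 6 * y - real r)" for d r
      by (simp add: algebra_simps)
    then show ?thesis by (simp only:)
  qed
  finally show ?thesis .
qed

text \<open>If some coordinate exceeded 1 on K, then at a point where it is maximal the expanding inverse
  map would increase it further. The function \<open>f\<close> is either a coordinate or one minus a coordinate,
  which gives upper and lower bounds together.\<close>

lemma K_sup_le_1: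
  fixes f :: "real \<times> real \<Rightarrow> real"
  assumes cont: "continuous_on K f"
    and step: "\<And>x y r d. r < 6 \<Longrightarrow> 0 \<le> d \<Longrightarrow> d \<le> 20 \<Longrightarrow>
      6 * f (x, y) - 5 \<le> f (6 * x - d / 4, 6 * y - real r)"
    and "z \<in> K"
  shows "f z \<le> 1"
proof -
  obtain x y where top: "(x, y) \<in> K" "\<And>w. w \<in> K \<Longrightarrow> f w \<le> f (x, y)"
    using continuous_attains_sup[OF K_attractor(1,2) cont] by auto
  obtain r d where rd: "r < 6" "d \<in> columns r"
      "(6 * x - d / 4, 6 * y - real r) \<in> K"
    using mem_K_iff top(1) by blast
  have "6 * f (x, y) - 5 \<le> f (6 * x - d / 4, 6 * y - real r)"
    using rd by (intro step) auto
  with top(2)[OF rd(3)] have "f (x, y) \<le> 1" by linarith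
  with top(2)[OF \<open>z \<in> K\<close>] show ?thesis by linarith
qed

lemma K_unit_square:
  assumes "(x, y) \<in> K" shows "0 \<le> x" "x \<le> 1" "0 \<le> y" "y \<le> 1"
proof -
  show "x \<le> 1"
    using K_sup_le_1[of fst, OF _ _ assms] by (simp add: continuous_intros)
  show "y \<le> 1"
    using K_sup_le_1[of snd, OF _ _ assms] by (simp add: continuous_intros)
  show "0 \<le> x"
    using K_sup_le_1[of "\<lambda>z. 1 - fst z", OF _ _ assms] by (simp add: continuous_intros)
  show "0 \<le> y"
    using K_sup_le_1[of "\<lambda>z. 1 - snd z", OF _ _ assms] by (simp add: continuous_intros)
qed

section \<open>Lines inside the attractor\<close>

text \<open>A point of \<open>A\<close> can be pulled back \<open>n\<close> times inside \<open>A\<close>, and the distance to K shrinks by the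
  factor 6 each time one returns. As \<open>A\<close> is bounded, the distance is 0.\<close>

lemma self_covered_subset_K:
  assumes "bounded A" and cover: "A \<subseteq> (\<Union>i\<in>{1..24}. ifs i ` A)"
  shows "A \<subseteq> K"
proof
  fix a assume "a \<in> A"
  obtain k where k: "k \<in> K" using K_attractor(2) by blast
  obtain B where B: "\<And>z. z \<in> A \<Longrightarrow> dist k z \<le> B"
    using assms(1) bounded_any_center[of A k] by blast
  have *: "infdist z K \<le> B / 6 ^ n" if "z \<in> A" for z n
    using that
  proof (induction n arbitrary: z)
    case 0
    then show ?case using infdist_le[OF k, of z] B[of z] by (simp add: dist_commute)
  next
    case (Suc n)
    then obtain i w where i: "i \<in> {1..24}" and w: "w \<in> A" "z = ifs i w" using cover by blast
    obtain b where b: "b \<in> K" "infdist w K = dist w b"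
      using infdist_attains_inf[OF compact_imp_closed[OF K_attractor(1)] K_attractor(2)] by metis
    have "ifs i b \<in> K" using b i K_attractor(3) by blast
    then have "infdist z K \<le> dist w b / 6"
      using infdist_le[of "ifs i b" K z] w(2) dist_ifs by metis
    with Suc.IH[OF w(1)] b show ?case by simp
  qed
  have "(\<lambda>n. B / 6 ^ n) \<longlonglongrightarrow> 0" by real_asymp
  then have "infdist a K \<le> 0"
    by (rule LIMSEQ_le_const) (use *[OF \<open>a \<in> A\<close>] in blast)
  then have "infdist a K = 0" using infdist_nonneg[of a K] by linarith
  then show "a \<in> K"
    using in_closed_iff_infdist_zero[OF compact_imp_closed[OF K_attractor(1)] K_attractor(2)] by blast
qed

text \<open>This is the form of the previous lemma by which explicit sets are shown to lie in K: it is
  enough that each point has an expanded image in the set again.\<close>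

lemma K_coinduct:
  assumes "\<And>x y. P x y \<Longrightarrow> 0 \<le> x \<and> x \<le> 1 \<and> 0 \<le> y \<and> y \<le> 1"
    and step: "\<And>x y. P x y \<Longrightarrow>
      \<exists>r<6. \<exists>d\<in>columns r. P (6 * x - d / 4) (6 * y - real r)"
    and "P x y"
  shows "(x, y) \<in> K"
proof -
  let ?A = "{(x, y). P x y}"
  have "?A \<subseteq> K"
  proof (rule self_covered_subset_K)
    have "?A \<subseteq> cbox (0, 0) (1, 1)" using assms(1) by (auto simp: cbox_Pair_eq)
    then show "bounded ?A" using bounded_cbox bounded_subset by blast
    show "?A \<subseteq> (\<Union>i\<in>{1..24}. ifs i ` ?A)"
    proof clarify
      fix x y assume "P x y"
      then obtain r d where rd: "r < 6" "d \<in> columns r"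
          "P (6 * x - d / 4) (6 * y - real r)"
        using step by blast
      then have "(d / 24, real r / 6) \<in> translation ` {1..24}"
        unfolding translation_image by blast
      then obtain i where i: "i \<in> {1..24}" "translation i = (d / 24, real r / 6)" by auto
      have "(x, y) = ifs i (6 * x - d / 4, 6 * y - real r)"
        by (simp add: ifs_def i(2) algebra_simps)
      with i(1) rd(3) show "(x, y) \<in> (\<Union>i\<in>{1..24}. ifs i ` ?A)" by blast
    qed
  qed
  with assms(3) show ?thesis by blast
qed

text \<open>Multiplication by 6 maps offsets to offsets, except for the largest one. This is 1/4, the
  distance between neighbouring lines of the skeleton below that have offset 0.\<close>

definition offsets :: "real set"
  where "offsets = insert 0 (range (\<lambda>n. 1 / 4 / 6 ^ n))"

text \<open>The right edge of the unit square, and lines of slope 1/4 in it that are carried into each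
  other by the expanding maps. The line with \<open>j = 0\<close> and offset 1/4 would consist of the corner
  (0, 1) alone, which is not in K.\<close>

definition skeleton :: "real \<Rightarrow> real \<Rightarrow> bool"
  where "skeleton x y \<longleftrightarrow> 0 \<le> y \<and> y \<le> 1 \<and>
    (x = 1 \<or> (\<exists>j\<in>{0,1,2}. \<exists>e\<in>offsets. x = (j + y) / 4 - e \<and> 0 \<le> x \<and> (j = 0 \<longrightarrow> e \<noteq> 1 / 4)))"

lemma offsets_cases:
  assumes "e \<in> offsets"
  shows "e = 1/4 \<or> (0 \<le> e \<and> e \<le> 1/24 \<and> 6 * e \<in> offsets)"
proof (cases "e = 0")
  case False
  then obtain n where n: "e = 1 / 4 / 6 ^ n" using assms by (auto simp: offsets_def)
  show ?thesis
  proof (cases n)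
    case (Suc m)
    then have "6 * e = 1 / 4 / 6 ^ m" "e = 1 / 24 / 6 ^ m" using n by auto
    then show ?thesis by (auto simp: offsets_def divide_le_eq)
  qed (use n in auto)
qed (auto simp: offsets_def)

text \<open>In a cell with left end \<open>d / 24\<close> in row \<open>r\<close>, the line with data \<open>j\<close>, \<open>e\<close> becomes the line with
  offset \<open>6 e\<close> and with \<open>6 j + r - d\<close> in the place of \<open>j\<close>. Choosing the third column for
  \<open>j = 2\<close>, the second for \<open>j = 1\<close> and the first for \<open>j = 0\<close> brings this number back to 2, except
  in the two lowest rows of the first column, where it is 0 and 1.\<close>

lemma skeleton_subset_K: "skeleton x y \<Longrightarrow> (x, y) \<in> K"
proof (rule K_coinduct[of skeleton])
  show "0 \<le> x \<and> x \<le> 1 \<and> 0 \<le> y \<and> y \<le> 1" if s: "skeleton x y" for x y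
  proof (cases "x = 1")
    case False
    then obtain j e where "j \<in> {0,1,2}" "e \<in> offsets" "x = (j + y) / 4 - e" "0 \<le> x" "0 \<le> y" "y \<le> 1"
      using s unfolding skeleton_def by blast
    moreover have "0 \<le> e" using offsets_cases[OF \<open>e \<in> offsets\<close>] by auto
    ultimately show ?thesis by (auto simp: field_simps)
  qed (use s in \<open>auto simp: skeleton_def\<close>)
next
  fix x y assume s: "skeleton x y"
  then have y: "0 \<le> y" "y \<le> 1" by (auto simp: skeleton_def)
  \<comment> \<open>The row is the upper one on the border between two rows: for a line that starts at height
    1/6 on the left edge, the square below contains only the corner excluded from the skeleton.\<close>
  obtain r :: nat where r: "r < 6" "real r \<le> 6 * y" "6 * y \<le> real r + 1"
    "y = 1 \<or> 6 * y < real r + 1"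
  proof (cases "y = 1")
    case True then show ?thesis using that[of 5] by auto
  next
    case False then show ?thesis using that[of "nat \<lfloor>6 * y\<rfloor>"] y by linarith
  qed
  show "\<exists>r<6. \<exists>d\<in>columns r.
      skeleton (6 * x - d / 4) (6 * y - real r)"
  proof (cases "x = 1")
    case True
    then have "skeleton (6 * x - 20 / 4) (6 * y - real r)" using r by (auto simp: skeleton_def)
    then show ?thesis using r(1) by blast
  next
    case False
    \<comment> \<open>An offset 1/4 is traded for the next line to the left with offset 0, so that multiplying
      by 6 stays within the offsets.\<close>
    obtain j e where je: "j \<in> {0,1,2}" "e \<in> offsets" "6 * e \<in> offsets" "0 \<le> e" "e \<le> 1/24"
      and x: "x = (j + y) / 4 - e" "0 \<le> x"
    proof -
      obtain j e where *: "j \<in> {0,1,2}" "e \<in> offsets" "x = (j + y) / 4 - e" "0 \<le> x"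
          "j = 0 \<longrightarrow> e \<noteq> 1 / 4"
        using s False unfolding skeleton_def by blast
      show ?thesis
      proof (cases "e = 1/4")
        case True
        then show ?thesis using * by (intro that[of "j - 1" 0]) (auto simp: offsets_def field_simps)
      next
        case False
        then show ?thesis using * offsets_cases[of e] by (intro that[of j e]) auto
      qed
    qed
    have line: "skeleton (6 * x - d / 4) (6 * y - real r)"
      if "d / 4 = (6 * j + real r - i) / 4" "i \<in> {0,1,2}" "i = 0 \<longrightarrow> 6 * e \<noteq> 1/4" "0 \<le> 6 * x - d / 4" for d i
    proof -
      have "6 * x - d / 4 = (i + (6 * y - real r)) / 4 - 6 * e"
        using that(1) x(1) by (simp add: field_simps)
      then show ?thesis using that je r unfolding skeleton_def by auto
    qed
    consider "j = 2" | "j = 1" | "j = 0" "r = 0" | "j = 0" "r = 1" | "j = 0" "r \<ge> 2"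
      using je(1) by force
    then show ?thesis
    proof cases
      case 1
      have "skeleton (6 * x - (real r + 10) / 4) (6 * y - real r)"
        using 1 r x je by (intro line[of _ 2]) (auto simp: field_simps)
      then show ?thesis using r(1) by blast
    next
      case 2
      have "skeleton (6 * x - (real r + 4) / 4) (6 * y - real r)"
        using 2 r x je by (intro line[of _ 2]) (auto simp: field_simps)
      then show ?thesis using r(1) by blast
    next
      case 3
      have "skeleton (6 * x - (max 0 (real r - 2)) / 4) (6 * y - real r)"
        using 3 r x je by (intro line[of _ 0]) (auto simp: field_simps)
      then show ?thesis using r(1) by blast
    next
      case 4
      have "skeleton (6 * x - (max 0 (real r - 2)) / 4) (6 * y - real r)"
        using 4 r x je by (intro line[of _ 1]) (auto simp: field_simps)
      then show ?thesis using r(1) by blast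
    next
      case 5
      have "skeleton (6 * x - (max 0 (real r - 2)) / 4) (6 * y - real r)"
        using 5 r x je by (intro line[of _ 2]) (auto simp: field_simps)
      then show ?thesis using r(1) by blast
    qed
  qed
qed

section \<open>Lines that miss the attractor\<close>

text \<open>For \<open>m = 0\<close> the line is 24x = 17/2 + 6y; in the row \<open>r\<close> it runs from \<open>r + 17/2\<close> to \<open>r + 19/2\<close>,
  strictly inside the gap between the second square, which ends at \<open>r + 8\<close>, and the third, which
  begins at \<open>r + 10\<close>. For larger \<open>m\<close> the line only meets squares of the third column, and in each
  of them it is the line for \<open>m - 1\<close>.\<close>

lemma K_avoids_line:
  "(1 / 2 - 7 / 48 / 6 ^ m + y / 4, y) \<notin> K"
proof (induction m arbitrary: y)
  case 0
  show ?case
  proof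
    assume "(1 / 2 - 7 / 48 / 6 ^ 0 + y / 4, y) \<in> K"
    then obtain r d where *: "r < 6" "d \<in> columns r"
      "(6 * (1 / 2 - 7 / 48 / 6 ^ 0 + y / 4) - d / 4, 6 * y - real r) \<in> K"
      using mem_K_iff by blast
    have "d \<le> real r \<or> d = real r + 4 \<or> d = real r + 10 \<or> d = 20" "real r \<le> 5"
      using *(1,2) by auto
    with K_unit_square[OF *(3)] show False by (elim disjE) (simp_all add: field_simps)
  qed
next
  case (Suc m)
  define c :: real where "c = 7 / 48 / 6 ^ m"
  have c: "0 < c" "c \<le> 7 / 48" by (auto simp: c_def field_simps)
  show ?case
  proof
    assume "(1 / 2 - 7 / 48 / 6 ^ Suc m + y / 4, y) \<in> K"
    then have "(1 / 2 - c / 6 + y / 4, y) \<in> K" by (simp add: c_def)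
    then obtain r d where *: "r < 6" "d \<in> columns r"
      "(6 * (1 / 2 - c / 6 + y / 4) - d / 4, 6 * y - real r) \<in> K"
      using mem_K_iff by blast
    have "d \<le> real r \<or> d = real r + 4 \<or> d = real r + 10 \<or> d = 20" "real r \<le> 5"
      using *(1,2) by auto
    with K_unit_square[OF *(3)] c have d: "d = real r + 10" by (elim disjE) (simp_all add: field_simps)
    have "6 * (1 / 2 - c / 6 + y / 4) - d / 4 = 1 / 2 - c + (6 * y - real r) / 4"
      using d by (simp add: field_simps)
    with *(3) Suc.IH[folded c_def] show False by metis
  qed
qed

text \<open>The map expands the level two square obtained from the square number 5 inside the square
  number 7 to the unit square. A point in the interior of this square lies in no other square of
  level two.\<close>

lemma K_zoom:
  assumes "(x, y) \<in> K" "0 < 36 * x - 13 / 2" "36 * x - 13 / 2 < 1" "0 < 36 * y - 4" "36 * y - 4 < 1"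
  shows "(36 * x - 13 / 2, 36 * y - 4) \<in> K"
proof -
  obtain r d where 1: "r < 6" "d \<in> columns r"
      "(6 * x - d / 4, 6 * y - real r) \<in> K"
    using assms(1) mem_K_iff by blast
  note sq1 = K_unit_square[OF 1(3)]
  have r: "r = 0" using sq1 assms by linarith
  then have "d = 4" using 1(2) sq1 assms by auto
  with 1 r have "(6 * x - 1, 6 * y) \<in> K" by simp
  then obtain s c where 2: "s < 6" "c \<in> columns s"
      "(6 * (6 * x - 1) - c / 4, 6 * (6 * y) - real s) \<in> K"
    using mem_K_iff by blast
  note sq2 = K_unit_square[OF 2(3)]
  have s: "s = 4" using sq2 assms by linarith
  then have "c = 2" using 2(2) sq2 assms by auto
  with 2 s show ?thesis by (simp add: algebra_simps)
qed

section \<open>Failure of local connectedness\<close>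

theorem lemma5:
  shows "\<exists>C\<in>components K. \<not> locally connected C"
proof -
  \<comment> \<open>\<open>S\<close> is the right edge of square 1. The points \<open>p\<close> and \<open>q n\<close> are the points at height 3/4 of
    the lines x = y/4 and x = y/4 - e, copied into square 7; at that height the lines cross the
    square number 5.\<close>
  define S where "S = Pair (1/6 :: real) ` {0..1/6 :: real}"
  define p where "p = (19/96 :: real, 1/8 :: real)"
  define q where "q n = (19/96 - 1 / 4 / 6 ^ Suc n / 6 :: real, 1/8 :: real)" for n :: nat
  define C where "C = connected_component_set K (1/6, 0)"
  have S_K: "S \<subseteq> K"
  proof
    fix z assume "z \<in> S"
    then obtain y where y: "z = (1/6, y)" "0 \<le> y" "y \<le> 1/6" by (auto simp: S_def)
    have "(1, 6 * y) \<in> K" using y by (intro skeleton_subset_K) (auto simp: skeleton_def)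
    then have "(1/6, y) \<in> K" by (subst mem_K_iff) (auto intro!: exI[of _ "0::nat"])
    then show "z \<in> K" using y by simp
  qed
  have S_conn: "connected S"
    unfolding S_def by (intro connected_continuous_image continuous_intros) auto
  have qC: "q n \<in> C" for n
  proof -
    define e :: real where "e = 1 / 4 / 6 ^ Suc n"
    have e: "0 < e" "e \<le> 1/24" "e \<in> offsets" by (auto simp: e_def offsets_def divide_le_eq simp del: power_Suc) (simp_all add: self_le_power)
    \<comment> \<open>The copy in square 7 of the line x = y/4 - e, from its start on the left edge.\<close>
    define L where "L = (\<lambda>y. (1/6 + (y / 4 - e) / 6, y / 6)) ` {4 * e..1}"
    have "L \<subseteq> K"
    proof
      fix z assume "z \<in> L"
      then obtain y where y: "z = (1/6 + (y / 4 - e) / 6, y / 6)" "4 * e \<le> y" "y \<le> 1"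
        by (auto simp: L_def)
      have "(y / 4 - e, y) \<in> K" 
        using y e by (intro skeleton_subset_K) (auto simp: skeleton_def)
      moreover have "6 * (1/6 + (y / 4 - e) / 6) - (real 0 + 4) / 4 = y / 4 - e" "6 * (y / 6) - real 0 = y"
        by (simp_all add: field_simps)
      ultimately have "(6 * (1/6 + (y / 4 - e) / 6) - (real 0 + 4) / 4, 6 * (y / 6) - real 0) \<in> K"
        by metis
      then have "(1/6 + (y / 4 - e) / 6, y / 6) \<in> K"
        unfolding mem_K_iff[of "1/6 + (y / 4 - e) / 6" "y / 6"]
        by (intro exI[of _ "0::nat"] conjI bexI[of _ "real 0 + 4"]) simp_all
      then show "z \<in> K" using y by simp
    qed
    moreover have "connected L"
      unfolding L_def by (intro connected_continuous_image continuous_intros) auto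
    moreover have "(1/6, 4 * e / 6) \<in> L" using e by (auto simp: L_def image_iff intro!: bexI[of _ "4 * e"])
    moreover have "(1/6, 4 * e / 6) \<in> S" using e by (auto simp: S_def)
    ultimately have "connected (S \<union> L)" "S \<union> L \<subseteq> K"
      using S_K S_conn by (auto intro!: connected_Un)
    moreover have "q n = (19/96 - e / 6, 1/8)" by (simp only: q_def e_def)
    then have "q n \<in> L" using e unfolding L_def
      by (intro image_eqI[of _ _ "3/4"]) (auto simp: field_simps)
    moreover have "(1/6, 0) \<in> S" by (auto simp: S_def)
    ultimately show ?thesis unfolding C_def
      by (intro connected_component_maximal[THEN subsetD, of _ "S \<union> L"]) auto
  qed
  have lim: "q \<longlonglongrightarrow> p"
  proof -
    have "(\<lambda>n. 19/96 - 1 / 4 / 6 ^ Suc n / 6 :: real) \<longlonglongrightarrow> 19/96" by real_asymp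
    then show ?thesis unfolding q_def p_def by (intro tendsto_Pair tendsto_const)
  qed
  have "(1/6, 0) \<in> K" using S_K by (auto simp: S_def)
  then have C: "C \<in> components K" by (auto simp: C_def components_def)
  then have "closed C" using K_attractor(1) closed_components compact_imp_closed by blast
  then have pC: "p \<in> C" using qC lim closed_sequentially by blast
  have "\<not> locally connected C"
  proof
    assume lc: "locally connected C"
    \<comment> \<open>The interior of the square in \<open>K_zoom\<close>.\<close>
    define U where "U = {13/72<..<15/72::real} \<times> {4/36<..<5/36::real}"
    have "openin (top_of_set C) (C \<inter> U)" unfolding U_def
      by (intro openin_open_Int open_Times) auto
    moreover have "p \<in> C \<inter> U" using pC by (auto simp: p_def U_def)
    ultimately obtain u v where uv: "openin (top_of_set C) u" "connected v" "p \<in> u" "u \<subseteq> v" "v \<subseteq> C \<inter> U"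
      using lc unfolding locally_def by meson
    obtain T where T: "open T" "u = C \<inter> T" using uv(1) by (auto simp: openin_open)
    have "\<forall>\<^sub>F n in sequentially. q n \<in> T"
      using lim T uv(3) by (intro topological_tendstoD) auto
    then obtain n where "q n \<in> T" by (auto simp: eventually_sequentially)
    then have qv: "q n \<in> v" and pv: "p \<in> v" using T uv qC by auto
    \<comment> \<open>The intercept x - y/4 of the line of slope 1/4 through the expanded point. It is 1/2 at
      \<open>p\<close> and \<open>1/2 - 1/4 / 6^n\<close> at \<open>q n\<close>, so the intercept of the line that misses K is between.\<close>
    define g where "g = (\<lambda>z :: real \<times> real. 36 * fst z - 9 * snd z - 11/2)"
    have "connected (g ` v)"
      unfolding g_def by (intro connected_continuous_image continuous_intros uv)
    then have "{g (q n)..g p} \<subseteq> g ` v"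
      using qv pv by (intro connected_contains_Icc) auto
    moreover have "1/2 - 7/48/6^n \<in> {g (q n)..g p}"
      by (simp add: g_def p_def q_def field_simps)
    ultimately obtain x y where xy: "(x, y) \<in> v" "g (x, y) = 1/2 - 7/48/6^n"
      by force
    have "(x, y) \<in> U" "(x, y) \<in> K" using xy uv C in_components_subset by blast+
    then have "(36 * x - 13 / 2, 36 * y - 4) \<in> K"
      by (intro K_zoom) (auto simp: U_def)
    moreover have "36 * x - 13 / 2 = 1/2 - 7/48/6^n + (36 * y - 4) / 4"
      using xy(2) by (simp add: g_def add_divide_distrib diff_divide_distrib)
    ultimately show False using K_avoids_line by metis
  qed
  with C show ?thesis by blast
qed

end
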